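(* Let $f:I\to I$ be measurable, let $\mathbf a=(a_k)_{k\ge0}$ be a strictly increasing sequence of nonnegative integers, and let $\mathcal D\subset C(I)$ be countable and dense in the uniform norm. Suppose that, for every $\phi\in\mathcal D$, there are $C_\phi<\infty$ and $\delta_\phi>0$ such that $$\sum_{0\le i,j<n}\left|\operatorname{Cov}_m\bigl(\phi\circ f^{a_i},\phi\circ f^{a_j}\bigr)\right|\le C_\phi n^{2-\delta_\phi}\qquad\text{for all }n\ge1.$$ Then the following condition holds: for every $\phi\in\mathcal D$ there are constants $C_\phi<\infty$ and $\delta_\phi>0$ such that, for all $n\ge1$, $$\int_I\left|\sum_{k=0}^{n-1}\left(\phi\circ f^{a_k}-\int_I\phi\circ f^{a_k}\,dm\right)\right|^2dm\le C_\phi n^{2-\delta_\phi}.$$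
   Context: $I=[-1,1]$, $m$ is normalized Lebesgue measure on $I$, $C(I)$ is the space of real-valued continuous functions on $I$, and for bounded measurable $F,H$ on $I$, $\operatorname{Cov}_m(F,H)=\int_I FH\,dm-\left(\int_IF\,dm\right)\left(\int_IH\,dm\right)$. *)

theory Defs
  imports "HOL-Analysis.Analysis" "HOL-Probability.Probability_Measure"
begin

abbreviation Ivl :: "real set" where
  "Ivl \<equiv> {-1..1}"

text \<open>
  The measure \<open>m\<close> lives on the Borel sigma-algebra of \<open>Ivl\<close>, and its space is \<open>Ivl\<close>, so that
  \<^term>\<open>f \<in> measurable mI mI\<close> says that \<open>f\<close> is a (Borel) measurable map from \<open>Ivl\<close> to \<open>Ivl\<close>.
\<close>
definition mI :: "real measure" where
  "mI = uniform_measure (restrict_space lborel Ivl) Ivl"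

text \<open>
  The real-valued continuous functions on \<open>Ivl\<close> with the supremum metric. As usual for the library
  function spaces, an element is represented by the total function that is \<open>undefined\<close>
  outside \<open>Ivl\<close>.
\<close>
abbreviation CI :: "(real \<Rightarrow> real) metric" where
  "CI \<equiv> cfunspace (top_of_set Ivl) euclidean_metric"

definition Cov :: "'a measure \<Rightarrow> ('a \<Rightarrow> real) \<Rightarrow> ('a \<Rightarrow> real) \<Rightarrow> real" where
  "Cov M F H = (\<integral>x. F x * H x \<partial>M) - (\<integral>x. F x \<partial>M) * (\<integral>x. H x \<partial>M)"

lemma space_mI [simp]: "space mI = Ivl"
  by (simp add: mI_def space_restrict_space)

lemma sets_mI [measurable_cong]: "sets mI = sets (restrict_space borel Ivl)"
  by (simp add: mI_def sets_restrict_space)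

lemma emeasure_mI:
  assumes "A \<in> sets mI"
  shows "emeasure mI A = emeasure lborel A / 2"
proof -
  have A: "A \<in> sets (restrict_space lborel Ivl)"
    using assms by (simp add: mI_def)
  have "A \<subseteq> Ivl"
    using sets.sets_into_space[OF assms] by simp
  moreover have "Ivl \<in> sets (restrict_space lborel Ivl)"
    by (simp add: sets_restrict_space_iff)
  ultimately show ?thesis
    using A unfolding mI_def
    by (simp add: emeasure_restrict_space Int_absorb1)
qed

lemma prob_space_mI: "prob_space mI"
proof
  have "Ivl \<in> sets mI"
    by (simp add: sets_mI sets_restrict_space_iff)
  then show "emeasure mI (space mI) = 1"
    by (simp add: emeasure_mI)
qed

lemma mspace_CI: "mspace CI = {\<phi> \<in> extensional Ivl. continuous_on Ivl \<phi>}"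
proof -
  have "bounded (\<phi> ` Ivl)" if "continuous_on Ivl \<phi>" for \<phi> :: "real \<Rightarrow> real"
    using that by (intro compact_imp_bounded compact_continuous_image) auto
  moreover have "Metric_space.mbounded UNIV dist S = bounded S" for S :: "real set"
    by (simp add: Met_TC.mbounded_def bounded_def subset_eq)
  ultimately show ?thesis
    by auto
qed

end

theory Submission
  imports Defs
begin

text \<open>The variance of a finite sum of square-integrable random variables is the sum of all
  their pairwise covariances; this is \<open>integral_sum_centred_square_eq_Cov\<close>. Apply it on
  the probability space \<open>mI\<close> to the observables \<phi> \<circ> f^(a_k). The integral in
  the conclusion is then exactly the double sum of signed covariances, which is at most the double
  sum of their absolute values. The assumed bound therefore carries over for each \<phi>, with the
  same C and \<delta>. What remains is integrability: \<phi> is bounded on the compact interval, and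
  the iterates of f stay in that interval.\<close>

lemma (in prob_space) integral_sum_centred_square_eq_Cov:
  fixes X :: "'i \<Rightarrow> 'a \<Rightarrow> real"
  assumes X: "\<And>i. i \<in> I \<Longrightarrow> integrable M (X i)"
    and XX: "\<And>i j. i \<in> I \<Longrightarrow> j \<in> I \<Longrightarrow> integrable M (\<lambda>x. X i x * X j x)"
  shows "(\<integral>x. (\<Sum>i\<in>I. X i x - (\<integral>y. X i y \<partial>M))\<^sup>2 \<partial>M) = (\<Sum>i\<in>I. \<Sum>j\<in>I. Cov M (X i) (X j))"
proof -
  define c where "c i = (\<integral>y. X i y \<partial>M)" for i
  have expand: "(X i x - c i) * (X j x - c j) = X i x * X j x - c j * X i x - c i * X j x + c i * c j"
    for i j x
    by (simp add: algebra_simps)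
  have int: "integrable M (\<lambda>x. (X i x - c i) * (X j x - c j))" if "i \<in> I" "j \<in> I" for i j
    unfolding expand using that X XX by simp
  \<comment> \<open>With total mass 1, the constant term integrates to c_i c_j. It cancels one of
    the two mixed terms, each of which contributes -c_i c_j, and leaves the covariance.\<close>
  have Cov: "(\<integral>x. (X i x - c i) * (X j x - c j) \<partial>M) = Cov M (X i) (X j)" if "i \<in> I" "j \<in> I" for i j
    unfolding expand using that X XX by (simp add: Cov_def prob_space flip: c_def)
  have "(\<integral>x. (\<Sum>i\<in>I. X i x - c i)\<^sup>2 \<partial>M)
      = (\<integral>x. (\<Sum>i\<in>I. \<Sum>j\<in>I. (X i x - c i) * (X j x - c j)) \<partial>M)"
    by (simp add: power2_eq_square sum_product)
  also have "\<dots> = (\<Sum>i\<in>I. \<Sum>j\<in>I. Cov M (X i) (X j))"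
    by (simp add: int Cov)
  finally show ?thesis
    by (simp add: c_def)
qed

theorem corollary5p2:
  fixes f :: "real \<Rightarrow> real" and a :: "nat \<Rightarrow> nat" and D :: "(real \<Rightarrow> real) set"
  assumes f: "f \<in> measurable mI mI"
    and a: "strict_mono a"
    and D_subset: "D \<subseteq> mspace CI"
    and D_countable: "countable D"
    and D_dense: "mtopology_of CI closure_of D = mspace CI"
    and cov_bound: "\<forall>\<phi>\<in>D. \<exists>C::real. \<exists>\<delta>::real. \<delta> > 0 \<and>
      (\<forall>n::nat. n \<ge> 1 \<longrightarrow>
        (\<Sum>i<n. \<Sum>j<n. \<bar>Cov mI (\<phi> \<circ> (f ^^ a i)) (\<phi> \<circ> (f ^^ a j))\<bar>)
          \<le> C * real n powr (2 - \<delta>))"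
  shows "\<forall>\<phi>\<in>D. \<exists>C::real. \<exists>\<delta>::real. \<delta> > 0 \<and>
      (\<forall>n::nat. n \<ge> 1 \<longrightarrow>
        (\<integral>x. \<bar>\<Sum>k<n. (\<phi> \<circ> (f ^^ a k)) x - (\<integral>y. (\<phi> \<circ> (f ^^ a k)) y \<partial>mI)\<bar>\<^sup>2 \<partial>mI)
          \<le> C * real n powr (2 - \<delta>))"
proof
  fix \<phi> assume \<phi>: "\<phi> \<in> D"
  interpret prob_space mI
    by (rule prob_space_mI)
  define X where "X k = \<phi> \<circ> (f ^^ a k)" for k
  have cont: "continuous_on Ivl \<phi>"
    using \<phi> D_subset by (auto simp: mspace_CI simp del: mspace_cfunspace)
  then have "\<phi> \<in> borel_measurable mI"
    by (simp add: borel_measurable_continuous_on_restrict measurable_cong_sets[OF sets_mI refl])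
  then have X_meas [measurable]: "X k \<in> borel_measurable mI" for k
    unfolding X_def by (rule measurable_comp[OF measurable_compose_n[OF f]])
  have "bounded (\<phi> ` Ivl)"
    using cont by (intro compact_imp_bounded compact_continuous_image) auto
  then obtain B where B: "\<And>x. x \<in> Ivl \<Longrightarrow> \<bar>\<phi> x\<bar> \<le> B"
    by (auto simp: bounded_iff simp del: atLeastAtMost_iff)
  \<comment> \<open>Every iterate of f maps \<open>Ivl\<close> into itself, so a single bound B for
    \<phi> serves all k and x.\<close>
  have X_bound: "\<bar>X k x\<bar> \<le> B" if "x \<in> Ivl" for k x
    using B measurable_space[OF measurable_compose_n[OF f]] that by (simp add: X_def)
  have X_int: "integrable mI (X k)" for k
    by (rule integrable_const_bound[where B = B, OF AE_I2]) (use X_bound in auto)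
  have XX_int: "integrable mI (\<lambda>x. X i x * X j x)" for i j
  proof (rule integrable_const_bound[where B = "B * B"])
    \<comment> \<open>Multiplying the two bounds requires 0 \<le> B, which follows from 0 \<le>
      \<bar>X k x\<bar> \<le> B at the point in question.\<close>
    show "AE x in mI. norm (X i x * X j x) \<le> B * B"
      by (rule AE_I2) (use X_bound in \<open>force simp: abs_mult intro!: mult_mono intro: order_trans[OF abs_ge_zero]\<close>)
  qed measurable
  \<comment> \<open>The outer absolute value disappears under the square; after the variance
    identity, each covariance is compared with its absolute value.\<close>
  have le: "(\<integral>x. \<bar>\<Sum>k<n. X k x - (\<integral>y. X k y \<partial>mI)\<bar>\<^sup>2 \<partial>mI) \<le> (\<Sum>i<n. \<Sum>j<n. \<bar>Cov mI (X i) (X j)\<bar>)" for n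
    by (simp add: integral_sum_centred_square_eq_Cov X_int XX_int sum_mono)
  show "\<exists>C::real. \<exists>\<delta>::real. \<delta> > 0 \<and>
      (\<forall>n::nat. n \<ge> 1 \<longrightarrow>
        (\<integral>x. \<bar>\<Sum>k<n. (\<phi> \<circ> (f ^^ a k)) x - (\<integral>y. (\<phi> \<circ> (f ^^ a k)) y \<partial>mI)\<bar>\<^sup>2 \<partial>mI)
          \<le> C * real n powr (2 - \<delta>))"
    using bspec[OF cov_bound \<phi>] le unfolding X_def by (meson order_trans)
qed

end
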